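(* Let $m,N$ be positive integers with $N\ge m$, and let $F=\sum_{\pi\in\Pi(m)}f_\pi\mu_\pi$ be a moment polynomial with arbitrary coefficients $f\in\mathbb{R}^{\Pi(m)}$. For $1\le i\le m$ put $$\eta_i=\left(\frac{N!/(N-i)!}{N^i}\right)^{-1}=\left(\prod_{j=N-i+1}^N\frac jN\right)^{-1}.$$ Then the nonstationary bootstrap approximation with $m$ steps and step sizes $\eta_1,\dots,\eta_m$ is unbiased, i.e. for all $X\in\mathcal{P}(\mathbb{R}^m)$ $$\big(\mathcal{S}\,\mathcal{B}_{\eta_m}\cdots\mathcal{B}_{\eta_1}F\big)(X)=F(X).$$
   Context: $\mathcal{P}(\mathbb{R}^m)$ is the set of probability measures on $\mathbb{R}^m$ with all moments finite. $\Pi(m)$ is the set of partitions of $\{1,\dots,m\}$, and $\mu_\pi(X)=\prod_{p\in\pi}\mathbb{E}_{x\sim X}[\prod_{i\in p}x_i]$. For $X\in\mathcal{P}(\mathbb{R}^m)$, $Y\sim_N X$ denotes $N$ independent samples from $X$, identified with their empirical distribution in $\mathcal{P}(\mathbb{R}^m)$. The resampling operator is $(\mathcal{S}G)(X)=\mathbb{E}_{Y\sim_N X}[G(Y)]$. For the fixed target functional $F$ and a step size $\eta\in\mathbb{R}$, the modified bootstrap operator is $\mathcal{B}_\eta G=G+\eta\,(F-\mathcal{S}G)$ (for $\eta=1$ this is the usual bootstrap operator $F-(\mathcal{S}G-G)$). The nonstationary bootstrap estimator of $F(X)$ with step sizes $\eta_1,\dots,\eta_k$ is $(\mathcal{B}_{\eta_k}\cdots\mathcal{B}_{\eta_1}F)(Y)$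 with $Y\sim_N X$; its bias is $(\mathcal{S}\mathcal{B}_{\eta_k}\cdots\mathcal{B}_{\eta_1}F)(X)-F(X)=\big(\prod_{i=1}^k(\mathrm{Id}-\eta_i\mathcal{S})(\mathcal{S}F-F)\big)(X)$. *)

theory Defs
  imports "HOL-Probability.Probability"
begin

text \<open>The dimension is the cardinality of the finite index type \<open>'m\<close>, whose elements play the role
  of the coordinates \<open>1, \<dots>, m\<close>.\<close>

definition moment_measures :: "(real ^ 'm) measure set" where
  "moment_measures = {X. prob_space X \<and> sets X = sets borel \<and>
     (\<forall>a :: 'm \<Rightarrow> nat. integrable X (\<lambda>x. \<Prod>i\<in>UNIV. (x $ i) ^ a i))}"

definition moment_monomial :: "'m set set \<Rightarrow> (real ^ 'm) measure \<Rightarrow> real" where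
  "moment_monomial \<pi> X = (\<Prod>p\<in>\<pi>. \<integral>x. (\<Prod>i\<in>p. x $ i) \<partial>X)"

definition moment_polynomial :: "('m::finite set set \<Rightarrow> real) \<Rightarrow> (real ^ 'm) measure \<Rightarrow> real" where
  "moment_polynomial f X = (\<Sum>\<pi> | partition_on UNIV \<pi>. f \<pi> * moment_monomial \<pi> X)"

definition empirical :: "nat \<Rightarrow> (nat \<Rightarrow> real ^ 'm) \<Rightarrow> (real ^ 'm) measure" where
  "empirical N y = distr (uniform_count_measure {..<N}) borel y"

text \<open>The product measure over \<open>{..<N}\<close> is the law of \<open>N\<close> independent samples from \<open>X\<close>.
  The functionals are total; only their values on \<^const>\<open>moment_measures\<close> are meaningful.\<close>

definition resample ::
    "nat \<Rightarrow> ((real ^ 'm) measure \<Rightarrow> real) \<Rightarrow> (real ^ 'm) measure \<Rightarrow> real" where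
  "resample N G X = (\<integral>y. G (empirical N y) \<partial>(Pi\<^sub>M {..<N} (\<lambda>_. X)))"

definition bootstrap_op ::
    "nat \<Rightarrow> ((real ^ 'm) measure \<Rightarrow> real) \<Rightarrow> real \<Rightarrow>
     ((real ^ 'm) measure \<Rightarrow> real) \<Rightarrow> (real ^ 'm) measure \<Rightarrow> real" where
  "bootstrap_op N F \<eta> G = (\<lambda>X. G X + \<eta> * (F X - resample N G X))"

text \<open>\<open>nonstationary_bootstrap N F \<eta> k\<close> is the functional obtained from \<open>F\<close> by applying first the
  operator with step size \<open>\<eta> 1\<close> and last the one with step size \<open>\<eta> k\<close>; \<open>\<eta> 0\<close> is never used.\<close>

primrec nonstationary_bootstrap ::
    "nat \<Rightarrow> ((real ^ 'm) measure \<Rightarrow> real) \<Rightarrow> (nat \<Rightarrow> real) \<Rightarrow> nat \<Rightarrow>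
     (real ^ 'm) measure \<Rightarrow> real" where
  "nonstationary_bootstrap N F \<eta> 0 = F"
| "nonstationary_bootstrap N F \<eta> (Suc k) =
     bootstrap_op N F (\<eta> (Suc k)) (nonstationary_bootstrap N F \<eta> k)"

definition step_size :: "nat \<Rightarrow> nat \<Rightarrow> real" where
  "step_size N i = inverse ((fact N / fact (N - i)) / real N ^ i)"

lemma step_size_prod:
  assumes "i \<le> N"
  shows "step_size N i = inverse (\<Prod>j = N - i + 1..N. real j / real N)"
proof -
  have "(\<Prod>j = N - i + 1..N. real j) = fact N / fact (N - i)"
    using assms
  proof (induction i)
    case (Suc i)
    have "{N - Suc i + 1..N} = insert (N - i) {N - i + 1..N}"
      using Suc.prems by auto
    moreover have fact_step: "(fact (N - i) :: real) = real (N - i) * fact (N - Suc i)"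
      using Suc.prems by (simp add: fact_reduce)
    ultimately have "(\<Prod>j = N - Suc i + 1..N. real j) =
        real (N - i) * (\<Prod>j = N - i + 1..N. real j)"
      by simp
    also have "\<dots> = real (N - i) * (fact N / fact (N - i))"
      using Suc by simp
    also have "\<dots> = fact N / fact (N - Suc i)"
      using Suc.prems by (simp add: fact_step del: of_nat_diff)
    finally show ?case .
  qed simp
  then show ?thesis
    using assms by (simp add: step_size_def prod_dividef)
qed

end

theory Submission imports Defs begin

text \<open>Write \<open>N\<close> samples as \<open>y 0, \<dots>, y (N - 1)\<close>. Expanding the moments of the empirical measure,
  \<open>\<mu>\<^sub>\<pi>\<close> becomes \<open>N ^ (- card \<pi>)\<close> times the sum of the products of the \<open>y (\<psi> i) $ i\<close> over all maps \<open>\<psi>\<close>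
  from coordinates to samples which are constant on the blocks of \<open>\<pi>\<close>. The expectation of such a
  product is \<open>\<mu>\<^sub>\<sigma>\<close>, where \<open>\<sigma>\<close> consists of the fibres of \<open>\<psi>\<close>; and exactly
  \<open>N (N - 1) \<dots> (N - card \<sigma> + 1)\<close> maps have the fibres \<open>\<sigma>\<close>. So resampling acts on the coefficients
  triangularly with respect to coarsening, and its diagonal entries are the inverse step sizes. The
  factor \<open>Id - \<eta> k * S\<close> thus sends the span of the \<open>\<mu>\<^sub>\<pi>\<close> with at most \<open>k\<close> blocks into the
  span of those with at most \<open>k - 1\<close> blocks. These factors commute, hence their product is zero.\<close>

subsection \<open>Partitions and maps that are constant on blocks\<close>

text \<open>For a partition of \<open>UNIV\<close> this is the quotient map onto the blocks. Where
  no unique block exists, the value is unspecified.\<close>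

definition block_of :: "'a set set \<Rightarrow> 'a \<Rightarrow> 'a set" where
  "block_of P x = (THE p. p \<in> P \<and> x \<in> p)"

text \<open>Indexing by points of the domain instead of values leaves out empty fibres, so the
  result is always a partition.\<close>

definition fibres :: "('a \<Rightarrow> 'b) \<Rightarrow> 'a set set" where
  "fibres \<psi> = range (\<lambda>x. \<psi> -` {\<psi> x})"

lemma block_of_eq:
  assumes "partition_on A P" "p \<in> P" "x \<in> p"
  shows "block_of P x = p"
  unfolding block_of_def
proof (rule the_equality)
  show "q = p" if "q \<in> P \<and> x \<in> q" for q
    using that assms by (auto simp: partition_on_def disjoint_def)
qed (use assms in auto)

lemma block_of_mem:
  assumes "partition_on UNIV P"
  shows "block_of P x \<in> P" "x \<in> block_of P x"
proof -
  obtain p where "p \<in> P" "x \<in> p"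
    using assms by (auto simp: partition_on_def)
  then show "block_of P x \<in> P" "x \<in> block_of P x"
    using block_of_eq[OF assms] by auto
qed

lemma range_block_of:
  assumes P: "partition_on UNIV P"
  shows "range (block_of P) = P"
proof
  show "P \<subseteq> range (block_of P)"
  proof
    fix p
    assume "p \<in> P"
    moreover from this obtain x where "x \<in> p"
      using P by (metis all_not_in_conv partition_onD3)
    ultimately show "p \<in> range (block_of P)"
      using block_of_eq[OF P] by (metis rangeI)
  qed
qed (use block_of_mem[OF P] in auto)

lemma card_partition_le:
  fixes P :: "'a::finite set set"
  assumes "partition_on UNIV P"
  shows "card P \<le> CARD('a)"
  using card_image_le[of UNIV "block_of P"] range_block_of[OF assms] by simp

lemma partition_on_fibres: "partition_on UNIV (fibres \<psi>)"
  by (auto simp: partition_on_def fibres_def disjoint_def)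

lemma refines_partition_on:
  assumes "refines A P Q"
  shows "partition_on A P" "partition_on A Q"
  using assms unfolding refines_def by blast+

text \<open>Turns constancy on blocks into the refinement order. Blocks are nonempty, so a point of
  \<open>p\<close> names the fibre that contains \<open>p\<close>.\<close>

lemma refines_fibres_iff:
  assumes "partition_on UNIV P"
  shows "refines UNIV P (fibres \<psi>) \<longleftrightarrow> (\<forall>p\<in>P. \<forall>x\<in>p. \<forall>y\<in>p. \<psi> x = \<psi> y)"
proof
  assume "refines UNIV P (fibres \<psi>)"
  then have sub: "\<exists>z. p \<subseteq> \<psi> -` {\<psi> z}" if "p \<in> P" for p
    using that unfolding refines_def fibres_def by blast
  show "\<forall>p\<in>P. \<forall>x\<in>p. \<forall>y\<in>p. \<psi> x = \<psi> y"
  proof (intro ballI)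
    fix p x y
    assume "p \<in> P" "x \<in> p" "y \<in> p"
    moreover from sub[OF this(1)] obtain z where "p \<subseteq> \<psi> -` {\<psi> z}" ..
    ultimately have "\<psi> x = \<psi> z" "\<psi> y = \<psi> z"
      by auto
    then show "\<psi> x = \<psi> y"
      by simp
  qed
next
  assume const: "\<forall>p\<in>P. \<forall>x\<in>p. \<forall>y\<in>p. \<psi> x = \<psi> y"
  have "\<exists>q\<in>fibres \<psi>. p \<subseteq> q" if p: "p \<in> P" for p
  proof -
    obtain x where "x \<in> p"
      using assms p by (metis all_not_in_conv partition_onD3)
    then have "p \<subseteq> \<psi> -` {\<psi> x}"
      using const p by blast
    then show ?thesis
      unfolding fibres_def by blast
  qed
  then show "refines UNIV P (fibres \<psi>)"
    using assms partition_on_fibres[of \<psi>] unfolding refines_def by blast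
qed

text \<open>Maps constant on the blocks are those that factor through the quotient. The inverse
  evaluates such a map at a chosen point of each block.\<close>

lemma bij_betw_comp_block_of:
  assumes P: "partition_on UNIV P"
  shows "bij_betw (\<lambda>g. g \<circ> block_of P) (P \<rightarrow>\<^sub>E T) {\<psi>. range \<psi> \<subseteq> T \<and> refines UNIV P (fibres \<psi>)}"
proof (rule bij_betwI[where g = "\<lambda>\<psi>. \<lambda>p\<in>P. \<psi> (SOME x. x \<in> p)"])
  have some: "(SOME x. x \<in> p) \<in> p" if "p \<in> P" for p
    using P that by (metis all_not_in_conv partition_onD3 someI_ex)
  have const: "block_of P x = block_of P y" if "p \<in> P" "x \<in> p" "y \<in> p" for p x y
    using block_of_eq[OF P that(1)] that by simp
  show "(\<lambda>g. g \<circ> block_of P) \<in> (P \<rightarrow>\<^sub>E T) \<rightarrow> {\<psi>. range \<psi> \<subseteq> T \<and> refines UNIV P (fibres \<psi>)}"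
  proof (intro Pi_I CollectI conjI)
    fix g
    assume "g \<in> P \<rightarrow>\<^sub>E T"
    then show "range (g \<circ> block_of P) \<subseteq> T"
      using block_of_mem(1)[OF P] by auto
    show "refines UNIV P (fibres (g \<circ> block_of P))"
      unfolding refines_fibres_iff[OF P] o_def by (intro ballI arg_cong[where f = g]) (rule const)
  qed
  show "(\<lambda>\<psi>. \<lambda>p\<in>P. \<psi> (SOME x. x \<in> p)) \<in>
      {\<psi>. range \<psi> \<subseteq> T \<and> refines UNIV P (fibres \<psi>)} \<rightarrow> (P \<rightarrow>\<^sub>E T)"
    by (intro Pi_I restrict_PiE_iff[THEN iffD2] ballI) blast
  show "(\<lambda>p\<in>P. (g \<circ> block_of P) (SOME x. x \<in> p)) = g" if "g \<in> P \<rightarrow>\<^sub>E T" for g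
  proof
    show "(\<lambda>p\<in>P. (g \<circ> block_of P) (SOME x. x \<in> p)) p = g p" for p
    proof (cases "p \<in> P")
      case True
      then show ?thesis
        using block_of_eq[OF P True some[OF True]] by simp
    next
      \<comment> \<open>Outside \<open>P\<close> both sides are \<open>undefined\<close>, by
        extensionality of \<open>g\<close>.\<close>
      case False
      then show ?thesis
        using PiE_arb[OF that] by simp
    qed
  qed
  show "(\<lambda>p\<in>P. \<psi> (SOME x. x \<in> p)) \<circ> block_of P = \<psi>"
    if "\<psi> \<in> {\<psi>. range \<psi> \<subseteq> T \<and> refines UNIV P (fibres \<psi>)}" for \<psi>
  proof
    show "((\<lambda>p\<in>P. \<psi> (SOME x. x \<in> p)) \<circ> block_of P) x = \<psi> x" for x
    proof -
      have "\<psi> (SOME y. y \<in> block_of P x) = \<psi> x"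
        using that some[OF block_of_mem(1)[OF P]] block_of_mem[OF P, of x]
        unfolding refines_fibres_iff[OF P] by blast
      then show ?thesis
        using block_of_mem(1)[OF P] by simp
    qed
  qed
qed

text \<open>Each fibre of the composite is a union of blocks, and two blocks merge exactly when
  \<open>g\<close> identifies them.\<close>

lemma fibres_comp_block_of_iff:
  assumes P: "partition_on UNIV P"
  shows "fibres (g \<circ> block_of P) = P \<longleftrightarrow> inj_on g P"
proof
  assume eq: "fibres (g \<circ> block_of P) = P"
  show "inj_on g P"
  proof (rule inj_onI)
    fix p q
    assume pq: "p \<in> P" "q \<in> P" "g p = g q"
    obtain x y where xy: "x \<in> p" "y \<in> q"
      using P pq by (metis all_not_in_conv partition_onD3)
    \<comment> \<open>This fibre is a single block of \<open>P\<close> by \<open>eq\<close>, yet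
      contains both \<open>x\<close> and \<open>y\<close>.\<close>
    let ?F = "(g \<circ> block_of P) -` {(g \<circ> block_of P) x}"
    have "?F \<in> P"
      using eq by (auto simp: fibres_def)
    moreover have "x \<in> ?F" "y \<in> ?F"
      using pq xy block_of_eq[OF P pq(1) xy(1)] block_of_eq[OF P pq(2) xy(2)] by auto
    ultimately have "block_of P x = block_of P y"
      using block_of_eq[OF P] by metis
    then show "p = q"
      using block_of_eq[OF P pq(1) xy(1)] block_of_eq[OF P pq(2) xy(2)] by metis
  qed
next
  assume inj: "inj_on g P"
  have fibre: "(g \<circ> block_of P) -` {(g \<circ> block_of P) x} = block_of P x" for x
  proof (intro equalityI subsetI)
    fix y
    assume "y \<in> (g \<circ> block_of P) -` {(g \<circ> block_of P) x}"
    then have "block_of P y = block_of P x"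
      using inj block_of_mem[OF P] by (auto dest: inj_onD)
    then show "y \<in> block_of P x"
      using block_of_mem(2)[OF P, of y] by simp
  next
    fix y
    assume "y \<in> block_of P x"
    then show "y \<in> (g \<circ> block_of P) -` {(g \<circ> block_of P) x}"
      using block_of_eq[OF P block_of_mem(1)[OF P], of y x] by simp
  qed
  show "fibres (g \<circ> block_of P) = P"
    by (simp only: fibres_def fibre range_block_of[OF P])
qed

text \<open>Such maps correspond to injections from \<open>P\<close> into \<open>T\<close>, hence
  the falling factorial. If \<open>T\<close> has fewer elements than \<open>P\<close>, the factor at
  \<open>j = card T\<close> makes the product zero.\<close>

lemma card_maps_with_fibres:
  fixes P :: "'a::finite set set"
  assumes P: "partition_on UNIV P" and "finite T"
  shows "card {\<psi>. range \<psi> \<subseteq> T \<and> fibres \<psi> = P} = (\<Prod>j<card P. card T - j)"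
proof -
  have "bij_betw (\<lambda>g. g \<circ> block_of P) {g \<in> P \<rightarrow>\<^sub>E T. inj_on g P}
      {\<psi>. range \<psi> \<subseteq> T \<and> fibres \<psi> = P}"
    unfolding bij_betw_def
  proof
    let ?c = "\<lambda>g. g \<circ> block_of P"
    have bij: "inj_on ?c (P \<rightarrow>\<^sub>E T)"
        "?c ` (P \<rightarrow>\<^sub>E T) = {\<psi>. range \<psi> \<subseteq> T \<and> refines UNIV P (fibres \<psi>)}"
      using bij_betw_comp_block_of[OF P] unfolding bij_betw_def by auto
    show "inj_on ?c {g \<in> P \<rightarrow>\<^sub>E T. inj_on g P}"
      using bij(1) by (rule inj_on_subset) auto
    have "?c ` {g \<in> P \<rightarrow>\<^sub>E T. inj_on g P} = {\<psi> \<in> ?c ` (P \<rightarrow>\<^sub>E T). fibres \<psi> = P}"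
      unfolding fibres_comp_block_of_iff[OF P, symmetric] by blast
    also have "\<dots> = {\<psi>. range \<psi> \<subseteq> T \<and> fibres \<psi> = P}"
      unfolding bij(2) using refines_refl[OF P] by auto
    finally show "?c ` {g \<in> P \<rightarrow>\<^sub>E T. inj_on g P} = {\<psi>. range \<psi> \<subseteq> T \<and> fibres \<psi> = P}" .
  qed
  then have "card {\<psi>. range \<psi> \<subseteq> T \<and> fibres \<psi> = P} = card {g \<in> P \<rightarrow>\<^sub>E T. inj_on g P}"
    by (simp add: bij_betw_same_card)
  also have "\<dots> = (\<Prod>j<card P. card T - j)"
    using card_inj_on_subset_funcset[of P T P] \<open>finite T\<close> by (simp add: lessThan_atLeast0)
  finally show ?thesis .
qed

section \<open>Refinement and the number of blocks\<close>

text \<open>Sending each block of \<open>P\<close> to the block of \<open>Q\<close> around it is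
  onto, since every point lies in some block of \<open>P\<close>. Both cardinality lemmas below rest
  on this map.\<close>

lemma refines_block_map:
  assumes ref: "refines UNIV P Q"
  shows "\<exists>h. h ` P = Q \<and> (\<forall>p\<in>P. \<forall>x\<in>p. h p = block_of Q x)"
proof -
  have P: "partition_on UNIV P" and Q: "partition_on UNIV Q"
    using ref refines_partition_on by blast+
  have "\<forall>p\<in>P. \<exists>q. q \<in> Q \<and> p \<subseteq> q"
    using ref unfolding refines_def by blast
  from bchoice[OF this] obtain h where "\<forall>p\<in>P. h p \<in> Q \<and> p \<subseteq> h p" ..
  then have h: "\<And>p. p \<in> P \<Longrightarrow> h p \<in> Q" "\<And>p. p \<in> P \<Longrightarrow> p \<subseteq> h p"
    by blast+
  have eq: "h p = block_of Q x" if "p \<in> P" "x \<in> p" for p x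
    using block_of_eq[OF Q h(1)[OF that(1)], of x] h(2)[OF that(1)] that(2) by auto
  have "h ` P = (\<lambda>x. h (block_of P x)) ` UNIV"
    unfolding image_image[of h "block_of P", symmetric] range_block_of[OF P] ..
  also have "\<dots> = Q"
    using eq[OF block_of_mem[OF P]] range_block_of[OF Q] by simp
  finally show ?thesis
    using eq by (intro exI[of _ h]) simp
qed

lemma card_le_of_refines:
  assumes "refines UNIV P Q" "finite P"
  shows "card Q \<le> card P"
proof -
  obtain h where "h ` P = Q"
    using refines_block_map[OF assms(1)] by blast
  then show ?thesis
    using card_image_le[OF assms(2), of h] by simp
qed

text \<open>The surjection between the blocks becomes injective, so no block of \<open>Q\<close>
  contains two blocks of \<open>P\<close>. Proper coarsening therefore strictly lowers the number of
  blocks.\<close>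

lemma refines_card_eq:
  assumes ref: "refines UNIV P Q" and "finite P" and card: "card P = card Q"
  shows "P = Q"
proof -
  have P: "partition_on UNIV P" and Q: "partition_on UNIV Q"
    using ref refines_partition_on by blast+
  obtain h where "h ` P = Q" and h: "\<forall>p\<in>P. \<forall>x\<in>p. h p = block_of Q x"
    using refines_block_map[OF ref] by blast
  then have inj: "inj_on h P"
    using \<open>finite P\<close> card by (simp add: eq_card_imp_inj_on)
  have "block_of P x = block_of Q x" for x
  proof
    show "block_of P x \<subseteq> block_of Q x"
    proof
      fix y
      assume "y \<in> block_of P x"
      then have "block_of Q y = block_of Q x"
        using h block_of_mem[OF P, of x] by metis
      then show "y \<in> block_of Q x"
        using block_of_mem(2)[OF Q, of y] by simp
    qed
    show "block_of Q x \<subseteq> block_of P x"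
    proof
      fix y
      assume "y \<in> block_of Q x"
      then have "block_of Q y = block_of Q x"
        by (rule block_of_eq[OF Q block_of_mem(1)[OF Q]])
      then have "h (block_of P y) = h (block_of P x)"
        using h block_of_mem[OF P, of x] block_of_mem[OF P, of y] by metis
      then have "block_of P y = block_of P x"
        using inj block_of_mem(1)[OF P] by (auto dest: inj_onD)
      then show "y \<in> block_of P x"
        using block_of_mem(2)[OF P, of y] by simp
    qed
  qed
  then have "range (block_of P) = range (block_of Q)"
    by simp
  then show ?thesis
    by (simp only: range_block_of[OF P] range_block_of[OF Q])
qed

subsection \<open>Resampling moment polynomials\<close>

text \<open>The matrix of resampling on coefficients: every \<open>\<pi>\<close> finer than
  \<open>\<sigma>\<close> contributes to the coefficient at \<open>\<sigma>\<close>, and the leading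
  factor counts the maps with fibres \<open>\<sigma>\<close>.\<close>

definition resample_coeff :: "nat \<Rightarrow> ('a set set \<Rightarrow> real) \<Rightarrow> 'a set set \<Rightarrow> real" where
  "resample_coeff N f \<sigma> =
     real (\<Prod>j<card \<sigma>. N - j) * (\<Sum>\<pi> | refines UNIV \<pi> \<sigma>. f \<pi> / real N ^ card \<pi>)"

lemma integral_empirical:
  fixes h :: "real ^ 'm \<Rightarrow> real"
  assumes "h \<in> borel_measurable borel"
  shows "integrable (empirical N y) h" "(\<integral>x. h x \<partial>empirical N y) = (\<Sum>j<N. h (y j)) / real N"
proof -
  have y: "y \<in> measurable (uniform_count_measure {..<N}) borel"
    by (simp add: uniform_count_measure_def point_measure_def)
  show "integrable (empirical N y) h"
    unfolding empirical_def using assms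
    by (subst integrable_distr_eq[OF y])
      (auto simp: uniform_count_measure_def intro: integrable_point_measure_finite)
  show "(\<integral>x. h x \<partial>empirical N y) = (\<Sum>j<N. h (y j)) / real N"
    unfolding empirical_def using assms
    by (simp add: integral_distr[OF y] integral_uniform_count_measure)
qed

text \<open>Lets a functional inside \<open>resample\<close> be replaced by one that agrees with it
  only on \<open>moment_measures\<close>.\<close>

lemma empirical_in_moment_measures:
  fixes y :: "nat \<Rightarrow> real ^ 'm"
  assumes "N > 0"
  shows "empirical N y \<in> moment_measures"
proof -
  have y: "y \<in> measurable (uniform_count_measure {..<N}) borel"
    by (simp add: uniform_count_measure_def point_measure_def)
  have "prob_space (uniform_count_measure {..<N})"
    using assms by (intro prob_space_uniform_count_measure) auto
  then have "prob_space (empirical N y)"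
    unfolding empirical_def using y by (rule prob_space.prob_space_distr)
  moreover have "integrable (empirical N y) (\<lambda>x. \<Prod>i\<in>UNIV. (x $ i) ^ a i)" for a :: "'m \<Rightarrow> nat"
    by (intro integral_empirical) measurable
  ultimately show ?thesis
    by (simp add: moment_measures_def empirical_def)
qed

text \<open>Multiplying out the product of sample means chooses one sample per block, which is a map
  constant on blocks.\<close>

lemma moment_monomial_empirical:
  fixes y :: "nat \<Rightarrow> real ^ 'm::finite"
  assumes \<pi>: "partition_on UNIV \<pi>"
  shows "moment_monomial \<pi> (empirical N y) =
    (\<Sum>\<psi> | range \<psi> \<subseteq> {..<N} \<and> refines UNIV \<pi> (fibres \<psi>). \<Prod>i\<in>UNIV. y (\<psi> i) $ i) / real N ^ card \<pi>"
proof -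
  have fin: "finite \<pi>"
    by (rule finite_elements[OF _ \<pi>]) simp
  have "moment_monomial \<pi> (empirical N y) = (\<Prod>p\<in>\<pi>. (\<Sum>j<N. \<Prod>i\<in>p. y j $ i) / real N)"
    unfolding moment_monomial_def by (intro prod.cong refl integral_empirical) measurable
  also have "\<dots> = (\<Sum>g\<in>\<pi> \<rightarrow>\<^sub>E {..<N}. \<Prod>p\<in>\<pi>. \<Prod>i\<in>p. y (g p) $ i) / real N ^ card \<pi>"
    using fin by (simp add: prod_dividef prod_sum_PiE)
  also have "(\<Sum>g\<in>\<pi> \<rightarrow>\<^sub>E {..<N}. \<Prod>p\<in>\<pi>. \<Prod>i\<in>p. y (g p) $ i) =
      (\<Sum>g\<in>\<pi> \<rightarrow>\<^sub>E {..<N}. \<Prod>i\<in>UNIV. y ((g \<circ> block_of \<pi>) i) $ i)"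
  proof (rule sum.cong[OF refl])
    fix g
    have "(\<Prod>p\<in>\<pi>. \<Prod>i\<in>p. y (g p) $ i) = (\<Prod>p\<in>\<pi>. \<Prod>i\<in>p. y ((g \<circ> block_of \<pi>) i) $ i)"
      by (intro prod.cong refl) (simp add: block_of_eq[OF \<pi>])
    also have "\<dots> = (\<Prod>i\<in>UNIV. y ((g \<circ> block_of \<pi>) i) $ i)"
      by (rule prod.partition[symmetric, OF _ \<pi>]) simp
    finally show "(\<Prod>p\<in>\<pi>. \<Prod>i\<in>p. y (g p) $ i) = \<dots>" .
  qed
  also have "\<dots> = (\<Sum>\<psi> | range \<psi> \<subseteq> {..<N} \<and> refines UNIV \<pi> (fibres \<psi>). \<Prod>i\<in>UNIV. y (\<psi> i) $ i)"
    by (rule sum.reindex_bij_betw[OF bij_betw_comp_block_of[OF \<pi>]])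
  finally show ?thesis .
qed

section \<open>Expectations over independent samples\<close>

lemma integrable_coordinate_prod:
  fixes X :: "(real ^ 'm::finite) measure"
  assumes "X \<in> moment_measures"
  shows "integrable X (\<lambda>x. \<Prod>i\<in>p. x $ i)"
proof -
  have "integrable X (\<lambda>x. \<Prod>i\<in>UNIV. (x $ i) ^ (if i \<in> p then 1 else 0))"
    using assms by (simp add: moment_measures_def)
  also have "(\<lambda>x :: real ^ 'm. \<Prod>i\<in>UNIV. (x $ i) ^ (if i \<in> p then 1 else 0)) = (\<lambda>x. \<Prod>i\<in>p. x $ i)"
  proof
    show "(\<Prod>i\<in>UNIV. (x $ i) ^ (if i \<in> p then 1 else 0)) = (\<Prod>i\<in>p. x $ i)" for x :: "real ^ 'm"
      by (rule prod.mono_neutral_cong_right) auto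
  qed
  finally show ?thesis .
qed

text \<open>Grouping the coordinates by the sample they use gives a product of functions of distinct
  samples, whose expectation factorizes by independence.\<close>

lemma has_bochner_integral_sample_prod:
  fixes X :: "(real ^ 'm::finite) measure" and \<psi> :: "'m \<Rightarrow> nat"
  assumes X: "X \<in> moment_measures" and \<psi>: "range \<psi> \<subseteq> {..<N}"
  shows "has_bochner_integral (Pi\<^sub>M {..<N} (\<lambda>_. X)) (\<lambda>y. \<Prod>i\<in>UNIV. y (\<psi> i) $ i)
    (moment_monomial (fibres \<psi>) X)"
proof -
  interpret prob_space X
    using X by (simp add: moment_measures_def)
  interpret product_sigma_finite "\<lambda>_. X" ..
  have fibre_prod: "(\<Prod>i\<in>UNIV. y (\<psi> i) $ i) = (\<Prod>j<N. \<Prod>i\<in>\<psi> -` {j}. y j $ i)" for y :: "nat \<Rightarrow> real ^ 'm"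
  proof -
    have "(\<Prod>i\<in>UNIV. y (\<psi> i) $ i) = (\<Prod>j<N. \<Prod>i\<in>{i. i \<in> UNIV \<and> \<psi> i = j}. y (\<psi> i) $ i)"
      using \<psi> by (intro prod.group[symmetric]) auto
    also have "\<dots> = (\<Prod>j<N. \<Prod>i\<in>\<psi> -` {j}. y j $ i)"
      by (intro prod.cong) auto
    finally show ?thesis .
  qed
  have "(\<Prod>j<N. \<integral>x. (\<Prod>i\<in>\<psi> -` {j}. x $ i) \<partial>X) =
      (\<Prod>j\<in>range \<psi>. \<integral>x. (\<Prod>i\<in>\<psi> -` {j}. x $ i) \<partial>X)"
  proof (rule prod.mono_neutral_right)
    show "\<forall>j\<in>{..<N} - range \<psi>. (\<integral>x. (\<Prod>i\<in>\<psi> -` {j}. x $ i) \<partial>X) = 1"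
    proof
      fix j
      assume "j \<in> {..<N} - range \<psi>"
      then have "\<psi> -` {j} = {}"
        by auto
      then show "(\<integral>x. (\<Prod>i\<in>\<psi> -` {j}. x $ i) \<partial>X) = 1"
        by (simp add: prob_space)
    qed
  qed (use \<psi> in auto)
  also have "\<dots> = moment_monomial ((\<lambda>j. \<psi> -` {j}) ` range \<psi>) X"
    unfolding moment_monomial_def by (subst prod.reindex) (auto simp: inj_on_def)
  also have "(\<lambda>j. \<psi> -` {j}) ` range \<psi> = fibres \<psi>"
    by (auto simp: fibres_def)
  finally have "(\<integral>y. (\<Prod>i\<in>UNIV. y (\<psi> i) $ i) \<partial>Pi\<^sub>M {..<N} (\<lambda>_. X)) = moment_monomial (fibres \<psi>) X"
    unfolding fibre_prod
    by (subst product_integral_prod) (auto intro: integrable_coordinate_prod[OF X])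
  moreover have "integrable (Pi\<^sub>M {..<N} (\<lambda>_. X)) (\<lambda>y. \<Prod>i\<in>UNIV. y (\<psi> i) $ i)"
    unfolding fibre_prod
    by (rule product_integrable_prod) (auto intro: integrable_coordinate_prod[OF X])
  ultimately show ?thesis
    by (simp add: has_bochner_integral_iff)
qed

lemma finite_partitions: "finite {\<pi> :: 'a::finite set set. P \<pi>}"
  by (rule finite_subset[OF subset_UNIV]) simp

lemma finite_maps_into:
  assumes "finite T"
  shows "finite {\<psi> :: 'a::finite \<Rightarrow> 'b. range \<psi> \<subseteq> T \<and> P \<psi>}"
proof (rule finite_subset)
  show "finite (UNIV \<rightarrow>\<^sub>E T :: ('a \<Rightarrow> 'b) set)"
    using assms by (intro finite_PiE) auto
qed auto

lemma sum_fibres: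
  fixes H :: "'a::finite set set \<Rightarrow> real"
  shows "(\<Sum>\<psi> | range \<psi> \<subseteq> {..<N} \<and> refines UNIV \<pi> (fibres \<psi>). H (fibres \<psi>)) =
    (\<Sum>\<sigma> | refines UNIV \<pi> \<sigma>. real (\<Prod>j<card \<sigma>. N - j) * H \<sigma>)"
proof -
  let ?S = "{\<psi> :: 'a \<Rightarrow> nat. range \<psi> \<subseteq> {..<N} \<and> refines UNIV \<pi> (fibres \<psi>)}"
  have "(\<Sum>\<psi>\<in>?S. H (fibres \<psi>)) =
      (\<Sum>\<sigma> | refines UNIV \<pi> \<sigma>. \<Sum>\<psi> | \<psi> \<in> ?S \<and> fibres \<psi> = \<sigma>. H (fibres \<psi>))"
    by (intro sum.group[symmetric] finite_maps_into finite_partitions) auto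
  also have "\<dots> = (\<Sum>\<sigma> | refines UNIV \<pi> \<sigma>. real (\<Prod>j<card \<sigma>. N - j) * H \<sigma>)"
  proof (rule sum.cong[OF refl])
    fix \<sigma>
    assume "\<sigma> \<in> {\<sigma>. refines UNIV \<pi> \<sigma>}"
    then have \<sigma>: "refines UNIV \<pi> \<sigma>" "partition_on UNIV \<sigma>"
      using refines_partition_on(2) by auto
    have "{\<psi>. \<psi> \<in> ?S \<and> fibres \<psi> = \<sigma>} = {\<psi>. range \<psi> \<subseteq> {..<N} \<and> fibres \<psi> = \<sigma>}"
      using \<sigma> by auto
    then show "(\<Sum>\<psi> | \<psi> \<in> ?S \<and> fibres \<psi> = \<sigma>. H (fibres \<psi>)) = real (\<Prod>j<card \<sigma>. N - j) * H \<sigma>"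
      using card_maps_with_fibres[OF \<sigma>(2), of "{..<N}"] by simp
  qed
  finally show ?thesis .
qed

lemma has_bochner_integral_moment_monomial_empirical:
  fixes X :: "(real ^ 'm::finite) measure"
  assumes X: "X \<in> moment_measures" and \<pi>: "partition_on UNIV \<pi>"
  shows "has_bochner_integral (Pi\<^sub>M {..<N} (\<lambda>_. X)) (\<lambda>y. moment_monomial \<pi> (empirical N y))
    ((\<Sum>\<sigma> | refines UNIV \<pi> \<sigma>. real (\<Prod>j<card \<sigma>. N - j) * moment_monomial \<sigma> X) / real N ^ card \<pi>)"
  unfolding moment_monomial_empirical[OF \<pi>] sum_fibres[symmetric]
  by (intro has_bochner_integral_divide_zero has_bochner_integral_sum
        has_bochner_integral_sample_prod[OF X]) auto

text \<open>Linearity gives a double sum over pairs with \<open>\<pi>\<close> refining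
  \<open>\<sigma>\<close>; exchanging the two sums collects the coefficient of each
  \<open>\<sigma>\<close>.\<close>

lemma resample_moment_polynomial:
  fixes X :: "(real ^ 'm::finite) measure"
  assumes X: "X \<in> moment_measures"
  shows "resample N (moment_polynomial f) X = moment_polynomial (resample_coeff N f) X"
proof -
  have "has_bochner_integral (Pi\<^sub>M {..<N} (\<lambda>_. X)) (\<lambda>y. moment_polynomial f (empirical N y))
    (\<Sum>\<pi> | partition_on UNIV \<pi>. f \<pi> *
      ((\<Sum>\<sigma> | refines UNIV \<pi> \<sigma>. real (\<Prod>j<card \<sigma>. N - j) * moment_monomial \<sigma> X) / real N ^ card \<pi>))"
    unfolding moment_polynomial_def
    by (intro has_bochner_integral_sum has_bochner_integral_mult_right
          has_bochner_integral_moment_monomial_empirical[OF X]) auto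
  then have "resample N (moment_polynomial f) X = (\<Sum>\<pi> | partition_on UNIV \<pi>. f \<pi> *
      ((\<Sum>\<sigma> | refines UNIV \<pi> \<sigma>. real (\<Prod>j<card \<sigma>. N - j) * moment_monomial \<sigma> X) / real N ^ card \<pi>))"
    unfolding resample_def by (rule has_bochner_integral_integral_eq)
  also have "\<dots> = (\<Sum>\<pi> | partition_on UNIV \<pi>. \<Sum>\<sigma> | refines UNIV \<pi> \<sigma>.
      real (\<Prod>j<card \<sigma>. N - j) * (f \<pi> / real N ^ card \<pi>) * moment_monomial \<sigma> X)"
    by (simp add: sum_distrib_left sum_divide_distrib mult_ac)
  also have "\<dots> = (\<Sum>\<pi> | partition_on UNIV \<pi>. \<Sum>\<sigma> | \<sigma> \<in> {\<sigma>. partition_on UNIV \<sigma>} \<and> refines UNIV \<pi> \<sigma>.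
      real (\<Prod>j<card \<sigma>. N - j) * (f \<pi> / real N ^ card \<pi>) * moment_monomial \<sigma> X)"
    by (intro sum.cong refl Collect_cong) (auto dest: refines_partition_on)
  also have "\<dots> = (\<Sum>\<sigma> | partition_on UNIV \<sigma>. \<Sum>\<pi> | \<pi> \<in> {\<pi>. partition_on UNIV \<pi>} \<and> refines UNIV \<pi> \<sigma>.
      real (\<Prod>j<card \<sigma>. N - j) * (f \<pi> / real N ^ card \<pi>) * moment_monomial \<sigma> X)"
    by (intro sum.swap_restrict finite_partitions)
  also have "\<dots> = (\<Sum>\<sigma> | partition_on UNIV \<sigma>. \<Sum>\<pi> | refines UNIV \<pi> \<sigma>.
      real (\<Prod>j<card \<sigma>. N - j) * (f \<pi> / real N ^ card \<pi>) * moment_monomial \<sigma> X)"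
    by (intro sum.cong refl Collect_cong) (auto dest: refines_partition_on)
  also have "\<dots> = moment_polynomial (resample_coeff N f) X"
    unfolding moment_polynomial_def resample_coeff_def
    by (simp add: sum_distrib_left sum_distrib_right)
  finally show ?thesis .
qed

subsection \<open>The commuting factors\<close>

lemma resample_coeff_diff:
  "resample_coeff N (\<lambda>\<pi>. f \<pi> - g \<pi>) = (\<lambda>\<sigma>. resample_coeff N f \<sigma> - resample_coeff N g \<sigma>)"
  by (simp add: fun_eq_iff resample_coeff_def diff_divide_distrib sum_subtractf right_diff_distrib)

lemma resample_coeff_scale:
  "resample_coeff N (\<lambda>\<pi>. c * f \<pi>) = (\<lambda>\<sigma>. c * resample_coeff N f \<sigma>)"
  by (simp add: fun_eq_iff resample_coeff_def mult.left_commute flip: sum_distrib_left times_divide_eq_right)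

text \<open>The factor Id - c S, acting on coefficients.\<close>

definition bias_step :: "nat \<Rightarrow> real \<Rightarrow> ('a set set \<Rightarrow> real) \<Rightarrow> 'a set set \<Rightarrow> real" where
  "bias_step N c h = (\<lambda>\<pi>. h \<pi> - c * resample_coeff N h \<pi>)"

primrec bias_steps :: "nat \<Rightarrow> (nat \<Rightarrow> real) \<Rightarrow> nat \<Rightarrow> ('a set set \<Rightarrow> real) \<Rightarrow> 'a set set \<Rightarrow> real" where
  "bias_steps N \<eta> 0 h = h"
| "bias_steps N \<eta> (Suc k) h = bias_step N (\<eta> (Suc k)) (bias_steps N \<eta> k h)"

text \<open>Both sides are the same polynomial in the linear map
  \<open>resample_coeff N\<close>.\<close>

lemma bias_step_commute: "bias_step N c (bias_step N d h) = bias_step N d (bias_step N c h)"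
  by (simp add: fun_eq_iff bias_step_def resample_coeff_diff resample_coeff_scale algebra_simps)

lemma bias_step_bias_steps: "bias_step N c (bias_steps N \<eta> k h) = bias_steps N \<eta> k (bias_step N c h)"
proof (induction k)
  case (Suc k)
  then show ?case
    by (simp add: bias_step_commute[of N c])
qed simp

text \<open>Tracks the coefficients \<open>g\<close> of the estimator together with
  \<open>h = f - S g\<close>, the negated bias. An update \<open>g + \<eta> h\<close> turns
  \<open>h\<close> into \<open>h - \<eta> S h\<close>, which is one
  \<open>bias_step\<close>.\<close>

lemma nonstationary_bootstrap_moment_polynomial:
  fixes f :: "'m::finite set set \<Rightarrow> real"
  assumes "N > 0"
  shows "\<exists>g. (\<forall>X\<in>moment_measures.
      nonstationary_bootstrap N (moment_polynomial f) \<eta> k X = moment_polynomial g X) \<and>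
    (\<lambda>\<pi>. f \<pi> - resample_coeff N g \<pi>) = bias_steps N \<eta> k (\<lambda>\<pi>. f \<pi> - resample_coeff N f \<pi>)"
proof (induction k)
  case 0
  show ?case
    by (intro exI[of _ f]) simp
next
  case (Suc k)
  let ?G = "nonstationary_bootstrap N (moment_polynomial f) \<eta> k"
  from Suc obtain g where
    g: "\<And>X. X \<in> moment_measures \<Longrightarrow> ?G X = moment_polynomial g X" and
    bias: "(\<lambda>\<pi>. f \<pi> - resample_coeff N g \<pi>) = bias_steps N \<eta> k (\<lambda>\<pi>. f \<pi> - resample_coeff N f \<pi>)"
    by blast
  let ?h = "\<lambda>\<pi>. f \<pi> - resample_coeff N g \<pi>"
  \<comment> \<open>The double negative gives the update the shape of a difference, as
    \<open>resample_coeff_diff\<close> expects.\<close>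
  let ?g' = "\<lambda>\<pi>. g \<pi> - (- \<eta> (Suc k)) * ?h \<pi>"
  have "nonstationary_bootstrap N (moment_polynomial f) \<eta> (Suc k) X = moment_polynomial ?g' X"
    if X: "X \<in> moment_measures" for X
  proof -
    have "resample N ?G X = resample N (moment_polynomial g) X"
      unfolding resample_def using g[OF empirical_in_moment_measures[OF assms]] by simp
    then have "resample N ?G X = moment_polynomial (resample_coeff N g) X"
      by (simp add: resample_moment_polynomial[OF X])
    then show ?thesis
      using g[OF X]
      by (simp add: bootstrap_op_def moment_polynomial_def algebra_simps sum.distrib sum_subtractf
          sum_distrib_left)
  qed
  moreover have "(\<lambda>\<pi>. f \<pi> - resample_coeff N ?g' \<pi>) = bias_step N (\<eta> (Suc k)) ?h"
    by (simp only: resample_coeff_diff[of N g] resample_coeff_scale bias_step_def)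
      (simp add: fun_eq_iff algebra_simps)
  ultimately show ?case
    using bias by (intro exI[of _ ?g']) auto
qed

section \<open>Step sizes cancelling the diagonal\<close>

text \<open>The bracket is the diagonal entry of \<open>resample_coeff\<close> at a partition into
  \<open>k\<close> blocks.\<close>

lemma step_size_mult_falling:
  assumes "k \<le> N" "N > 0"
  shows "step_size N k * (real (\<Prod>j<k. N - j) / real N ^ k) = 1"
proof -
  have "real (\<Prod>j<k. N - j) * fact (N - k) = fact N"
    using \<open>k \<le> N\<close>
  proof (induction k)
    case (Suc k)
    then have "(fact (N - k) :: real) = real (N - k) * fact (N - Suc k)"
      by (simp add: fact_reduce)
    with Suc show ?case
      by (simp add: mult_ac del: of_nat_diff)
  qed simp
  then have "real (\<Prod>j<k. N - j) = fact N / fact (N - k)"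
    by (simp add: field_simps)
  then show ?thesis
    using \<open>N > 0\<close> by (simp add: step_size_def)
qed

text \<open>A proper refinement of \<open>\<sigma>\<close> has more than \<open>Suc k\<close>
  blocks, so only the diagonal term survives. With exactly \<open>Suc k\<close> blocks the step size
  cancels it; with more, \<open>h \<sigma>\<close> is already zero.\<close>

lemma bias_step_vanishes:
  fixes h :: "'a::finite set set \<Rightarrow> real"
  assumes N: "CARD('a) \<le> N"
    and h: "\<And>\<pi>. partition_on UNIV \<pi> \<Longrightarrow> card \<pi> > Suc k \<Longrightarrow> h \<pi> = 0"
    and \<sigma>: "partition_on UNIV \<sigma>" "card \<sigma> > k"
  shows "bias_step N (step_size N (Suc k)) h \<sigma> = 0"
proof -
  have vanish: "h \<pi> = 0" if "refines UNIV \<pi> \<sigma>" "\<pi> \<noteq> \<sigma>" for \<pi>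
  proof -
    have "card \<sigma> \<le> card \<pi>" "card \<pi> \<noteq> card \<sigma>"
      using card_le_of_refines[OF that(1)] refines_card_eq[OF that(1)] that(2) by auto
    with \<sigma> show ?thesis
      using refines_partition_on(1)[OF that(1)] by (intro h) auto
  qed
  have "(\<Sum>\<pi> | refines UNIV \<pi> \<sigma>. h \<pi> / real N ^ card \<pi>) = (\<Sum>\<pi>\<in>{\<sigma>}. h \<pi> / real N ^ card \<pi>)"
    using refines_refl[OF \<sigma>(1)] vanish by (intro sum.mono_neutral_right finite_partitions) auto
  then have coeff: "resample_coeff N h \<sigma> = real (\<Prod>j<card \<sigma>. N - j) / real N ^ card \<sigma> * h \<sigma>"
    by (simp add: resample_coeff_def)
  show ?thesis
  proof (cases "card \<sigma> = Suc k")
    case True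
    have "N > 0"
      using N by (meson less_le_trans zero_less_card_finite)
    have "step_size N (Suc k) * (real (\<Prod>j<card \<sigma>. N - j) / real N ^ card \<sigma>) = 1"
      unfolding True using N True \<open>N > 0\<close> card_partition_le[OF \<sigma>(1)]
      by (intro step_size_mult_falling) auto
    then show ?thesis
      by (simp only: bias_step_def coeff flip: mult.assoc)
  next
    case False
    then have "h \<sigma> = 0"
      using \<sigma> by (intro h) auto
    then show ?thesis
      by (simp add: bias_step_def coeff)
  qed
qed

text \<open>The step sizes are applied in increasing order, so the factor that removes the finest
  partitions comes last; it has to be moved to the front.\<close>

lemma bias_steps_vanish:
  fixes h :: "'a::finite set set \<Rightarrow> real"
  assumes "CARD('a) \<le> N"
    and "\<And>\<pi>. partition_on UNIV \<pi> \<Longrightarrow> card \<pi> > k \<Longrightarrow> h \<pi> = 0"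
    and \<sigma>: "partition_on UNIV \<sigma>"
  shows "bias_steps N (step_size N) k h \<sigma> = 0"
  using assms(2)
proof (induction k arbitrary: h)
  case 0
  \<comment> \<open>A partition of the nonempty \<open>UNIV\<close> has at least one block, so the
    hypothesis at bound 0 already covers \<open>\<sigma>\<close>.\<close>
  have "\<sigma> \<noteq> {}"
    using \<sigma> by (auto simp: partition_on_def)
  then show ?case
    using 0 \<sigma> by (simp add: card_gt_0_iff)
next
  case (Suc k)
  have "bias_steps N (step_size N) (Suc k) h \<sigma> =
      bias_steps N (step_size N) k (bias_step N (step_size N (Suc k)) h) \<sigma>"
    by (simp add: bias_step_bias_steps)
  also have "\<dots> = 0"
    by (rule Suc.IH) (use bias_step_vanishes[OF assms(1)] Suc.prems in blast)
  finally show ?case .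
qed

theorem theorem5p10:
  fixes f :: "'m::finite set set \<Rightarrow> real"
    and N :: nat
    and X :: "(real ^ 'm) measure"
  assumes "N \<ge> CARD('m)"
    and "X \<in> moment_measures"
  shows "resample N
           (nonstationary_bootstrap N (moment_polynomial f) (step_size N) CARD('m)) X =
         moment_polynomial f X"
proof -
  have "N > 0"
    using assms(1) by (meson less_le_trans zero_less_card_finite)
  then obtain g where
    g: "\<And>X. X \<in> moment_measures \<Longrightarrow>
      nonstationary_bootstrap N (moment_polynomial f) (step_size N) CARD('m) X = moment_polynomial g X" and
    bias: "(\<lambda>\<pi>. f \<pi> - resample_coeff N g \<pi>) =
      bias_steps N (step_size N) CARD('m) (\<lambda>\<pi>. f \<pi> - resample_coeff N f \<pi>)"
    using nonstationary_bootstrap_moment_polynomial[of N f "step_size N" "CARD('m)"] by blast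
  \<comment> \<open>Agreement on partitions suffices, since \<open>moment_polynomial\<close> sums
    over nothing else.\<close>
  have coeff: "resample_coeff N g \<pi> = f \<pi>" if "partition_on UNIV \<pi>" for \<pi>
  proof -
    have "bias_steps N (step_size N) CARD('m) (\<lambda>\<pi>. f \<pi> - resample_coeff N f \<pi>) \<pi> = 0"
    proof (rule bias_steps_vanish[OF assms(1) _ that])
      \<comment> \<open>Vacuous: a partition has at most \<open>CARD('m)\<close> blocks, which is
        why that many steps are enough.\<close>
      show "f \<rho> - resample_coeff N f \<rho> = 0" if "partition_on UNIV \<rho>" "CARD('m) < card \<rho>" for \<rho>
        using card_partition_le[OF that(1)] that(2) by simp
    qed
    then show ?thesis
      using fun_cong[OF bias, of \<pi>] by simp
  qed
  have "resample N (nonstationary_bootstrap N (moment_polynomial f) (step_size N) CARD('m)) X =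
      resample N (moment_polynomial g) X"
    unfolding resample_def using g[OF empirical_in_moment_measures[OF \<open>N > 0\<close>]] by simp
  also have "\<dots> = moment_polynomial (resample_coeff N g) X"
    by (rule resample_moment_polynomial[OF assms(2)])
  also have "\<dots> = moment_polynomial f X"
    unfolding moment_polynomial_def by (intro sum.cong refl) (simp add: coeff)
  finally show ?thesis .
qed

end
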